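(* For all integers $0\le i\le n$ and all $x\in\mathbb{Z}_p$, $$\sum_{k=i}^{n}\frac{\binom{k}{i}}{\binom{n}{i}}B_{k,n}(x,q)=\sum_{k=0}^{i}q^{\binom{k}{2}}\,k!\,\binom{i}{k}\binom{x}{k}_q\,\beta_{i-k,q}^{(-k)}.$$
   Context: Let $p$ be a fixed prime, $\mathbb{Z}_p$ the $p$-adic integers, and $\mathbb{C}_p$ the completion of an algebraic closure of $\mathbb{Q}_p$, with $|p|_p=1/p$. Let $q\in\mathbb{C}_p$ with $|1-q|_p<1$, $q$ not a root of unity (in particular $q\neq1$). For $x\in\mathbb{Z}_p$, $q^x$ denotes the continuous extension of $m\mapsto q^m$, and $[x]_q=\frac{1-q^x}{1-q}$, $[x]_{1/q}=\frac{1-q^{-x}}{1-q^{-1}}$. Binomial coefficients without subscript $q$ are ordinary. Kim's $q$-Bernstein polynomials on $\mathbb{Z}_p$: $B_{k,n}(x,q)=\binom{n}{k}[x]_q^k\,[1-x]_{1/q}^{\,n-k}$. For $x\in\mathbb{Z}_p$ and $k\ge0$, $\binom{x}{k}_q=\frac{[x]_q[x-1]_q\cdots[x-k+1]_q}{[k]_q!}$ with $[k]_q!=[k]_q\cdots[1]_q$, $[0]_q!=1$, $\binom x0_q=1$. The $p$-adic $q$-integral is $\int_{\mathbb{Z}_p}f(x)\,d\mu_q(x)=\lim_{N\to\infty}\frac{1}{[p^N]_q}\sum_{x=0}^{p^N-1}f(x)q^x$. The inverse $q$-Bernoulli numbers of order $k\ge 0$ are, for $n\ge0$, $$\beta_{n,q}^{(-k)}=\frac{1}{(1-q)^n}\sum_{j=0}^n\frac{(-1)^j\binom{n}{j}}{\int_{\mathbb{Z}_p}\cdots\int_{\mathbb{Z}_p}q^{\sum_{l=1}^k(k-l+j)x_l}\,d\mu_q(x_1)\cdots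 d\mu_q(x_k)},$$ where the $k$-fold iterated integral is interpreted as $1$ when $k=0$. *)

theory Defs
  imports "HOL-Analysis.Analysis" "HOL-Computational_Algebra.Polynomial"
begin

text \<open>
  All objects live in one type \<open>'a\<close>, a complete metric field; the predicate \<open>padic_complex\<close>
  below says that it is a completion of an algebraic closure of the field of \<open>p\<close>-adic numbers, with
  the metric induced by the absolute value \<open>abv\<close>. (The library's \<open>norm\<close> is restricted to
  real normed spaces.) As \<open>abv\<close> extends the \<open>p\<close>-adic absolute value of the rationals, the
  \<open>p\<close>-adic numbers inside \<open>'a\<close> are the topological closure of the rationals.
\<close>

definition abv :: "'a :: {field_char_0, metric_space} \<Rightarrow> real" where
  "abv x = dist x 0"

definition Q_p :: "'a :: {field_char_0, metric_space} set" where
  "Q_p = closure \<rat>"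

definition Z_p :: "'a :: {field_char_0, metric_space} set" where
  "Z_p = {x \<in> Q_p. abv x \<le> 1}"

definition Q_p_bar :: "'a :: {field_char_0, metric_space} set" where
  "Q_p_bar = {x. \<exists>P. P \<noteq> 0 \<and> (\<forall>i. coeff P i \<in> Q_p) \<and> poly P x = 0}"

text \<open>
  Completeness is part of the sort. Multiplicativity, the ultrametric inequality and
  \<open>abv p = 1/p\<close> force \<open>abv\<close> to be the \<open>p\<close>-adic absolute value on the rationals.
\<close>

definition padic_complex :: "nat \<Rightarrow> 'a :: {field_char_0, complete_space} itself \<Rightarrow> bool" where
  "padic_complex p _ \<longleftrightarrow>
     (\<forall>x y :: 'a. dist x y = abv (x - y)) \<and>
     (\<forall>x y :: 'a. abv (x * y) = abv x * abv y) \<and>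
     (\<forall>x y :: 'a. abv (x + y) \<le> max (abv x) (abv y)) \<and>
     abv (of_nat p :: 'a) = 1 / real p \<and>
     (\<forall>P :: 'a poly. degree P > 0 \<and> (\<forall>i. coeff P i \<in> Q_p_bar) \<longrightarrow> (\<exists>x\<in>Q_p_bar. poly P x = 0)) \<and>
     closure (Q_p_bar :: 'a set) = UNIV"

text \<open>
  The continuous extension to \<open>Z_p\<close> of \<open>m \<mapsto> q ^ m\<close>. For \<open>abv (1 - q) < 1\<close> it exists and its
  values on \<open>Z_p\<close> are unique, because the natural numbers are dense in \<open>Z_p\<close>; values outside
  \<open>Z_p\<close> are arbitrary.
\<close>

definition qpow :: "'a :: {field_char_0, metric_space} \<Rightarrow> 'a \<Rightarrow> 'a" where
  "qpow q = (SOME f. continuous_on Z_p f \<and> (\<forall>m::nat. f (of_nat m) = q ^ m))"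

definition qnum :: "'a :: {field_char_0, metric_space} \<Rightarrow> 'a \<Rightarrow> 'a" where
  "qnum q x = (1 - qpow q x) / (1 - q)"

text \<open>The number \<open>[x]\<close> to the base \<open>1/q\<close>.\<close>

definition qnum_inv :: "'a :: {field_char_0, metric_space} \<Rightarrow> 'a \<Rightarrow> 'a" where
  "qnum_inv q x = (1 - qpow q (- x)) / (1 - inverse q)"

definition qbernstein :: "nat \<Rightarrow> nat \<Rightarrow> 'a :: {field_char_0, metric_space} \<Rightarrow> 'a \<Rightarrow> 'a" where
  "qbernstein k n x q = of_nat (n choose k) * qnum q x ^ k * qnum_inv q (1 - x) ^ (n - k)"

definition qfact :: "'a :: {field_char_0, metric_space} \<Rightarrow> nat \<Rightarrow> 'a" where
  "qfact q k = (\<Prod>i=1..k. qnum q (of_nat i))"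

definition qbinomial :: "'a :: {field_char_0, metric_space} \<Rightarrow> 'a \<Rightarrow> nat \<Rightarrow> 'a" where
  "qbinomial q x k = (\<Prod>i<k. qnum q (x - of_nat i)) / qfact q k"

definition qintegral ::
  "nat \<Rightarrow> 'a :: {field_char_0, metric_space} \<Rightarrow> ('a \<Rightarrow> 'a) \<Rightarrow> 'a" where
  "qintegral p q f =
     lim (\<lambda>N. 1 / qnum q (of_nat (p ^ N)) * (\<Sum>x<p ^ N. f (of_nat x) * q ^ x))"

text \<open>
  Iterated integral of a function of \<open>x 1, \<dots>, x k\<close>, with \<open>x 1\<close> innermost and \<open>x k\<close> outermost.
  For \<open>k = 0\<close> it is the value of the function, which ignores its argument then.
\<close>

primrec qintegral_iter ::
  "nat \<Rightarrow> 'a :: {field_char_0, metric_space} \<Rightarrow> nat \<Rightarrow> ((nat \<Rightarrow> 'a) \<Rightarrow> 'a) \<Rightarrow> 'a" where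
  "qintegral_iter p q 0 f = f (\<lambda>_. 0)"
| "qintegral_iter p q (Suc k) f =
     qintegral p q (\<lambda>y. qintegral_iter p q k (\<lambda>x. f (x(Suc k := y))))"

text \<open>
  \<open>inv_qbernoulli p q k n\<close> is the \<open>n\<close>-th inverse q-Bernoulli number of order \<open>-k\<close>. For \<open>k = 0\<close>
  the integral is \<open>qpow q 0 = 1\<close>.
\<close>

definition inv_qbernoulli ::
  "nat \<Rightarrow> 'a :: {field_char_0, metric_space} \<Rightarrow> nat \<Rightarrow> nat \<Rightarrow> 'a" where
  "inv_qbernoulli p q k n =
     1 / (1 - q) ^ n *
     (\<Sum>j=0..n. (-1) ^ j * of_nat (n choose j) /
        qintegral_iter p q k (\<lambda>x. qpow q (\<Sum>l=1..k. of_nat (k - l + j) * x l)))"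

end

theory Submission
  imports Defs
begin

text \<open>
  Both sides of the identity equal \<open>qnum q x ^ i\<close>.

  On the left, \<open>qnum q x + qnum_inv q (1 - x) = 1\<close> (\<open>qnum_add_qnum_inv\<close>), so for \<open>i = 0\<close> the
  Bernstein functions sum to one; for general \<open>i\<close> the weights \<open>(k choose i) / (n choose i)\<close> turn the
  binomial expansion of exponent \<open>n\<close> into \<open>a ^ i\<close> times the one of exponent \<open>n - i\<close>
  (\<open>sum_choose_bernstein\<close>).

  On the right, the integral of \<open>q ^ (c * x)\<close> is the quotient of \<open>c + 1\<close> by the q-number of \<open>c + 1\<close>,
  because the Riemann sums are geometric and \<open>q ^ (p ^ N)\<close> tends to \<open>1\<close>. The variables of the
  iterated integral separate, so the integral is a product of such quotients
  (\<open>qintegral_iter_bernoulli_weight\<close>). Its reciprocal supplies both the ordinary factorials that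
  combine \<open>(i choose k)\<close> and \<open>(i - k choose j)\<close> into \<open>(i choose (j + k))\<close>, and the q-numbers that
  form a Gaussian binomial coefficient with the denominator of \<open>qbinomial\<close>. After grouping by
  \<open>m = j + k\<close> the sum over \<open>k\<close> is the q-Newton expansion of the power \<open>X ^ m\<close>, where
  \<open>X = qpow q x\<close>, in the polynomials \<open>\<Prod>l<k. X - q ^ l\<close> (\<open>power_eq_sum_gauss_binomial\<close>), and the
  sum over \<open>m\<close> is the binomial theorem for \<open>(1 - X) ^ i\<close> (\<open>sum_inverse_bernoulli_expansion\<close>).

  The analytic content is that \<open>qpow q\<close> really is the continuous extension of the powers of \<open>q\<close>.
  The estimate \<open>abv_1_minus_q_power_p_le\<close> makes these powers uniformly continuous on the natural
  numbers for the \<open>p\<close>-adic metric; since the natural numbers are dense in \<open>Z_p\<close>, the extension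
  exists, and the functional equation \<open>qpow_add_of_nat\<close> passes to the limit.
\<close>

section \<open>Gaussian binomial coefficients and q-Newton expansion\<close>

text \<open>
  The recursion gives the coefficients in any commutative ring, for every \<open>q\<close>, where the quotient of
  q-factorials need not make sense.
\<close>

fun gauss_binomial :: "'a :: comm_ring_1 \<Rightarrow> nat \<Rightarrow> nat \<Rightarrow> 'a" where
  "gauss_binomial q m 0 = 1"
| "gauss_binomial q 0 (Suc k) = 0"
| "gauss_binomial q (Suc m) (Suc k) = gauss_binomial q m k + q ^ Suc k * gauss_binomial q m (Suc k)"

lemma gauss_binomial_eq_0: "m < k \<Longrightarrow> gauss_binomial q m k = 0"
  by (induction q m k rule: gauss_binomial.induct) auto

lemma gauss_binomial_self: "gauss_binomial q k k = 1"
  by (induction k) (auto simp: gauss_binomial_eq_0)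

text \<open>
  The usual product formula, with the denominator cleared. Writing the upper index as \<open>j + k\<close> makes
  both entries of the Pascal rule instances of the formula with a smaller \<open>j + k\<close>.
\<close>

lemma gauss_binomial_mult_prod:
  fixes q :: "'a :: comm_ring_1"
  shows "gauss_binomial q (j + k) k * (\<Prod>l=1..k. 1 - q ^ l) = (\<Prod>l=1..k. 1 - q ^ (j + l))"
proof (induction "j + k" arbitrary: j k)
  case 0
  then show ?case by simp
next
  case (Suc n)
  show ?case
  proof (cases "j = 0 \<or> k = 0")
    case True
    then show ?thesis by (auto simp: gauss_binomial_self)
  next
    case False
    then obtain j' k' where jk: "j = Suc j'" "k = Suc k'"
      by (metis not0_implies_Suc)
    define A where "A = (\<Prod>l=1..k'. 1 - q ^ (j + l))"
    have A1: "gauss_binomial q (j + k') k' * (\<Prod>l=1..k'. 1 - q ^ l) = A"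
      unfolding A_def using Suc jk by (intro Suc.hyps(1)) auto
    have "(\<Prod>l=1..k. 1 - q ^ (j' + l)) = (1 - q ^ j) * A"
      unfolding jk A_def by (simp add: prod.atLeast_Suc_atMost prod.atLeast_Suc_atMost_Suc_shift
          del: prod.cl_ivl_Suc)
    then have A2: "gauss_binomial q (j' + k) k * (\<Prod>l=1..k. 1 - q ^ l) = (1 - q ^ j) * A"
      using Suc.hyps(1)[of j' k] Suc.hyps(2) jk by simp
    have "gauss_binomial q (j + k) k * (\<Prod>l=1..k. 1 - q ^ l) =
          gauss_binomial q (j + k') k' * (\<Prod>l=1..k'. 1 - q ^ l) * (1 - q ^ k) +
          q ^ k * (gauss_binomial q (j' + k) k * (\<Prod>l=1..k. 1 - q ^ l))"
      unfolding jk by (simp add: algebra_simps)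
    also have "\<dots> = A * (1 - q ^ (j + k))"
      unfolding A1 A2 by (simp add: algebra_simps power_add)
    also have "\<dots> = (\<Prod>l=1..k. 1 - q ^ (j + l))"
      unfolding A_def jk by simp
    finally show ?thesis .
  qed
qed

text \<open>
  The q-Newton expansion of a power at the nodes \<open>1, q, q ^ 2, \<dots>\<close>: multiplying the \<open>k\<close>-th basis
  polynomial by \<open>X\<close> gives the next one plus \<open>q ^ k\<close> times itself, which is the Pascal rule read on
  coefficients.
\<close>

lemma power_eq_sum_gauss_binomial:
  fixes q X :: "'a :: comm_ring_1"
  shows "X ^ m = (\<Sum>k\<le>m. gauss_binomial q m k * (\<Prod>l<k. X - q ^ l))"
proof (induction m)
  case 0
  then show ?case by simp
next
  case (Suc m)
  define P where "P = (\<lambda>k. \<Prod>l<k. X - q ^ l)"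
  have P_Suc: "X * P k = P (Suc k) + q ^ k * P k" for k
    by (simp add: P_def algebra_simps)
  have "X ^ Suc m = (\<Sum>k\<le>m. gauss_binomial q m k * (X * P k))"
    by (simp add: Suc P_def sum_distrib_left algebra_simps)
  also have "\<dots> = (\<Sum>k\<le>m. gauss_binomial q m k * P (Suc k)) +
                  (\<Sum>k\<le>m. q ^ k * gauss_binomial q m k * P k)"
    by (simp add: P_Suc distrib_left sum.distrib mult_ac)
  also have "(\<Sum>k\<le>m. q ^ k * gauss_binomial q m k * P k) =
             (\<Sum>k\<le>Suc m. q ^ k * gauss_binomial q m k * P k)"
    by (simp add: gauss_binomial_eq_0)
  also have "\<dots> = 1 + (\<Sum>k\<le>m. q ^ Suc k * gauss_binomial q m (Suc k) * P (Suc k))"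
    by (subst sum.atMost_Suc_shift) (simp add: P_def)
  also have "(\<Sum>k\<le>m. gauss_binomial q m k * P (Suc k)) + \<dots> =
             1 + (\<Sum>k\<le>m. gauss_binomial q (Suc m) (Suc k) * P (Suc k))"
    by (simp add: sum.distrib algebra_simps)
  also have "\<dots> = (\<Sum>k\<le>Suc m. gauss_binomial q (Suc m) k * P k)"
    by (subst sum.atMost_Suc_shift) (simp add: P_def)
  finally show ?case by (simp only: P_def)
qed

section \<open>The two sums evaluated algebraically\<close>

lemma sum_choose_bernstein:
  fixes a b :: "'a :: field_char_0"
  assumes "i \<le> n" "a + b = 1"
  shows "(\<Sum>k=i..n. of_nat (k choose i) / of_nat (n choose i) *
            (of_nat (n choose k) * a ^ k * b ^ (n - k))) = a ^ i"
proof -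
  have nz: "(of_nat (n choose i) :: 'a) \<noteq> 0"
    using assms(1) by (simp add: binomial_eq_0_iff)
  have "(\<Sum>k=i..n. of_nat (k choose i) / of_nat (n choose i) *
            (of_nat (n choose k) * a ^ k * b ^ (n - k))) =
        (\<Sum>k=i..n. of_nat ((n - i) choose (k - i)) * a ^ k * b ^ (n - k))"
  proof (rule sum.cong)
    fix k assume k: "k \<in> {i..n}"
    have "(of_nat (n choose k) * of_nat (k choose i) :: 'a) =
          of_nat (n choose i) * of_nat ((n - i) choose (k - i))"
      using choose_mult[of i k n] k by (metis atLeastAtMost_iff of_nat_mult)
    then show "of_nat (k choose i) / of_nat (n choose i) *
            (of_nat (n choose k) * a ^ k * b ^ (n - k)) =
          of_nat ((n - i) choose (k - i)) * a ^ k * b ^ (n - k)"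
      using nz by (simp add: field_simps)
  qed simp
  also have "\<dots> = (\<Sum>k\<le>n - i. of_nat ((n - i) choose k) * a ^ (k + i) * b ^ (n - i - k))"
    by (rule sum.reindex_bij_witness[of _ "\<lambda>k. k + i" "\<lambda>k. k - i"]) (use assms in auto)
  also have "\<dots> = a ^ i * (a + b) ^ (n - i)"
    by (simp add: binomial_ring power_add sum_distrib_left algebra_simps)
  finally show ?thesis using assms by simp
qed

text \<open>
  The denominator is \<open>(j + k)! / j!\<close>. Hence the ordinary factorials of the \<open>(k, j)\<close> term on the right
  of the theorem depend on \<open>j + k\<close> only.
\<close>

lemma fact_choose_div_prod:
  assumes "j + k \<le> i"
  shows "fact k * of_nat (i choose k) * of_nat ((i - k) choose j) / (\<Prod>m=1..k. of_nat (j + m)) =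
         (of_nat (i choose (j + k)) :: 'a :: field_char_0)"
proof -
  have pr: "(fact (j + k) :: 'a) = fact j * (\<Prod>m=1..k. of_nat (j + m))"
    by (induction k) (auto simp: algebra_simps)
  then have "(\<Prod>m=1..k. of_nat (j + m)) = (fact (j + k) / fact j :: 'a)"
    by (simp add: field_simps)
  moreover have "i - k - j = i - (j + k)" by simp
  ultimately show ?thesis
    using assms by (simp add: binomial_fact field_simps)
qed

text \<open>
  Since \<open>k choose 2\<close> is \<open>0 + 1 + \<dots> + (k - 1)\<close>, the power of \<open>q\<close> clears the denominators
  \<open>q ^ l\<close>. This converts the numerator of a q-binomial coefficient into a q-Newton basis polynomial.
\<close>

lemma power_choose_two_mult_prod:
  fixes q X :: "'a :: field"
  assumes "q \<noteq> 0"
  shows "q ^ (k choose 2) * (\<Prod>l<k. 1 - X / q ^ l) = (- 1) ^ k * (\<Prod>l<k. X - q ^ l)"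
proof (induction k)
  case (Suc k)
  have "q ^ (Suc k choose 2) * (\<Prod>l<Suc k. 1 - X / q ^ l) =
        (q ^ (k choose 2) * (\<Prod>l<k. 1 - X / q ^ l)) * (q ^ k * (1 - X / q ^ k))"
    by (simp add: numeral_2_eq_2 power_add)
  also have "q ^ k * (1 - X / q ^ k) = - (X - q ^ k)"
    using assms by (simp add: field_simps)
  finally show ?case by (simp add: Suc algebra_simps)
qed (simp add: numeral_2_eq_2)

text \<open>
  The right-hand side of the theorem as an identity of rational functions in \<open>q\<close> and \<open>X = q ^ x\<close>,
  after the integrals have been evaluated. Every power of \<open>1 - q\<close> in the \<open>(k, j)\<close> term collects into
  \<open>(1 - q) ^ i\<close>.
\<close>

lemma sum_inverse_bernoulli_expansion:
  fixes q X :: "'a :: field_char_0"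
  assumes q0: "q \<noteq> 0" and roots: "\<And>m::nat. m > 0 \<Longrightarrow> q ^ m \<noteq> 1"
  shows "(\<Sum>k=0..i. q ^ (k choose 2) * fact k * of_nat (i choose k) *
            ((\<Prod>l<k. (1 - X / q ^ l) / (1 - q)) / (\<Prod>l=1..k. (1 - q ^ l) / (1 - q))) *
            (1 / (1 - q) ^ (i - k) * (\<Sum>j=0..i - k. (- 1) ^ j * of_nat ((i - k) choose j) /
               (\<Prod>m=1..k. of_nat (j + m) / ((1 - q ^ (j + m)) / (1 - q)))))) =
         ((1 - X) / (1 - q)) ^ i"
proof -
  have q1: "1 - q \<noteq> 0" using roots[of 1] by simp
  define P where "P = (\<lambda>k. \<Prod>l<k. X - q ^ l)"
  define D where "D = (\<lambda>k. \<Prod>l=1..k. 1 - q ^ l)"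
  have D: "D k \<noteq> 0" for k
    using roots by (auto simp: D_def)
  have term_eq: "q ^ (k choose 2) * fact k * of_nat (i choose k) *
            ((\<Prod>l<k. (1 - X / q ^ l) / (1 - q)) / (\<Prod>l=1..k. (1 - q ^ l) / (1 - q))) *
            (1 / (1 - q) ^ (i - k) * ((- 1) ^ j * of_nat ((i - k) choose j) /
               (\<Prod>m=1..k. of_nat (j + m) / ((1 - q ^ (j + m)) / (1 - q))))) =
          of_nat (i choose (j + k)) * (- 1) ^ (j + k) * gauss_binomial q (j + k) k * P k
            / (1 - q) ^ i"
    if "j + k \<le> i" for j k
  proof -
    define N where "N = (\<Prod>m=1..k. (of_nat (j + m) :: 'a))"
    define E where "E = (\<Prod>l<k. 1 - X / q ^ l)"
    have gb: "gauss_binomial q (j + k) k = (\<Prod>l=1..k. 1 - q ^ (j + l)) / D k"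
      using gauss_binomial_mult_prod[of q j k] D[of k] by (simp add: D_def field_simps)
    have qE: "q ^ (k choose 2) * E = (- 1) ^ k * P k"
      using power_choose_two_mult_prod[OF q0] by (simp add: E_def P_def)
    have ch: "of_nat (i choose (j + k)) =
        fact k * of_nat (i choose k) * of_nat ((i - k) choose j) / N"
      using fact_choose_div_prod[OF that, where 'a = 'a] by (simp add: N_def)
    have pw: "(1 - q) ^ i = (1 - q) ^ k * (1 - q) ^ (i - k)"
      using that by (simp flip: power_add)
    have p1: "(\<Prod>l<k. (1 - X / q ^ l) / (1 - q)) = E / (1 - q) ^ k"
      unfolding E_def by (simp add: prod_dividef)
    have p2: "(\<Prod>l=1..k. (1 - q ^ l) / (1 - q)) = D k / (1 - q) ^ k"
      unfolding D_def by (simp add: prod_dividef)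
    have p3: "(\<Prod>m=1..k. of_nat (j + m) / ((1 - q ^ (j + m)) / (1 - q))) =
        N * (1 - q) ^ k / (\<Prod>l=1..k. 1 - q ^ (j + l))"
      unfolding N_def by (simp add: prod_dividef prod.distrib)
    have "q ^ (k choose 2) * fact k * of_nat (i choose k) *
            ((\<Prod>l<k. (1 - X / q ^ l) / (1 - q)) / (\<Prod>l=1..k. (1 - q ^ l) / (1 - q))) *
            (1 / (1 - q) ^ (i - k) * ((- 1) ^ j * of_nat ((i - k) choose j) /
               (\<Prod>m=1..k. of_nat (j + m) / ((1 - q ^ (j + m)) / (1 - q))))) =
          (fact k * of_nat (i choose k) * of_nat ((i - k) choose j) / N) *
          (q ^ (k choose 2) * E) * (- 1) ^ j * ((\<Prod>l=1..k. 1 - q ^ (j + l)) / D k) /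
          ((1 - q) ^ k * (1 - q) ^ (i - k))"
      unfolding p1 p2 p3 using q1 by (simp add: mult_ac)
    also have "\<dots> = of_nat (i choose (j + k)) * ((- 1) ^ k * P k) * (- 1) ^ j *
          gauss_binomial q (j + k) k / (1 - q) ^ i"
      by (simp only: qE ch gb pw)
    finally show ?thesis by (simp add: power_add mult_ac)
  qed
  define F where "F = (\<lambda>k j. of_nat (i choose (j + k)) * (- 1) ^ (j + k) *
      gauss_binomial q (j + k) k * P k / (1 - q) ^ i)"
  have "(\<Sum>k=0..i. q ^ (k choose 2) * fact k * of_nat (i choose k) *
            ((\<Prod>l<k. (1 - X / q ^ l) / (1 - q)) / (\<Prod>l=1..k. (1 - q ^ l) / (1 - q))) *
            (1 / (1 - q) ^ (i - k) * (\<Sum>j=0..i - k. (- 1) ^ j * of_nat ((i - k) choose j) /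
               (\<Prod>m=1..k. of_nat (j + m) / ((1 - q ^ (j + m)) / (1 - q)))))) =
        (\<Sum>k=0..i. \<Sum>j=0..i - k. F k j)"
    unfolding sum_distrib_left F_def by (intro sum.cong refl term_eq) auto
  also have "\<dots> = (\<Sum>(k, j)\<in>{(k, j). k + j \<le> i}. F k j)"
    unfolding sum.Sigma[OF finite_atLeastAtMost ballI[OF finite_atLeastAtMost]]
    by (rule sum.cong) auto
  also have "\<dots> = (\<Sum>m\<le>i. \<Sum>k\<le>m. F k (m - k))"
    by (rule sum.triangle_reindex_eq)
  also have "\<dots> = (\<Sum>m\<le>i. of_nat (i choose m) * (- 1) ^ m / (1 - q) ^ i *
                    (\<Sum>k\<le>m. gauss_binomial q m k * P k))"
    unfolding sum_distrib_left by (intro sum.cong refl) (simp add: F_def mult_ac)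
  also have "\<dots> = (\<Sum>m\<le>i. of_nat (i choose m) * (- X) ^ m * 1 ^ (i - m)) / (1 - q) ^ i"
    unfolding P_def power_eq_sum_gauss_binomial[symmetric] sum_divide_distrib
    by (intro sum.cong refl) (simp add: power_minus[of X])
  also have "\<dots> = ((1 - X) / (1 - q)) ^ i"
    by (simp add: binomial_ring[symmetric] power_divide del: power_one mult_1_right)
  finally show ?thesis .
qed

section \<open>Ultrametric estimates and density of the natural numbers in \<open>Z_p\<close>\<close>

locale padic_complex_field =
  fixes p :: nat and T :: "'a :: {field_char_0, complete_space} itself"
  assumes prime_p: "prime p" and padic: "padic_complex p T"
begin

lemma
  fixes x y :: 'a
  shows dist_abv: "dist x y = abv (x - y)"
    and abv_mult: "abv (x * y) = abv x * abv y"
    and abv_add_le_max: "abv (x + y) \<le> max (abv x) (abv y)"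
    and abv_p: "abv (of_nat p :: 'a) = 1 / real p"
  using padic by (auto simp: padic_complex_def)

lemma abv_nonneg: "abv x \<ge> 0" for x :: 'a
  by (simp add: abv_def)

lemma abv_eq_0_iff: "abv x = 0 \<longleftrightarrow> x = 0" for x :: 'a
  by (simp add: abv_def)

lemma abv_1: "abv (1 :: 'a) = 1"
  using abv_mult[of 1 1] abv_eq_0_iff[of 1] by simp

lemma abv_minus: "abv (- x) = abv x" for x :: 'a
proof -
  have "abv (- 1 :: 'a) ^ 2 = 1"
    using abv_mult[of "- 1" "- 1"] abv_1 by (simp add: power2_eq_square)
  then have "abv (- 1 :: 'a) = 1"
    using abv_nonneg[of "- 1"] by (simp add: power2_eq_1_iff)
  then show ?thesis using abv_mult[of "- 1" x] by simp
qed

lemma abv_diff_commute: "abv (x - y) = abv (y - x)" for x y :: 'a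
  using abv_minus[of "x - y"] by simp

lemma abv_diff_le_max: "abv (x - y) \<le> max (abv x) (abv y)" for x y :: 'a
  using abv_add_le_max[of x "- y"] by (simp add: abv_minus)

lemma dist_ultrametric: "dist x z \<le> max (dist x y) (dist y z)" for x y z :: 'a
  using abv_add_le_max[of "x - y" "y - z"] by (simp add: dist_abv)

lemma abv_power: "abv (x ^ n) = abv x ^ n" for x :: 'a
  by (induction n) (auto simp: abv_1 abv_mult)

lemma abv_sum_le:
  fixes f :: "'b \<Rightarrow> 'a"
  assumes "\<And>i. i \<in> A \<Longrightarrow> abv (f i) \<le> c" "0 \<le> c"
  shows "abv (sum f A) \<le> c"
  using assms
proof (induction A rule: infinite_finite_induct)
  case (insert i A)
  then show ?case
    using abv_add_le_max[of "f i" "sum f A"] by fastforce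
qed (auto simp: abv_def)

lemma abv_of_nat_le_1: "abv (of_nat n :: 'a) \<le> 1"
  using abv_sum_le[of "{..<n}" "\<lambda>_. 1" 1] abv_1 by simp

lemma abv_of_int_le_1: "abv (of_int k :: 'a) \<le> 1"
  by (cases k) (auto simp: abv_minus abv_of_nat_le_1 simp del: of_nat_Suc)

lemma p_gt_1: "p > 1"
  using prime_p by (rule prime_gt_1_nat)

text \<open>
  By Bezout, \<open>1\<close> is an integral combination of \<open>k\<close> and \<open>p\<close>; if \<open>abv k < 1\<close>, both summands would have
  absolute value below \<open>1\<close>, against the ultrametric inequality.
\<close>

lemma abv_of_int_coprime:
  assumes "\<not> int p dvd k"
  shows "abv (of_int k :: 'a) = 1"
proof (rule ccontr)
  assume "abv (of_int k :: 'a) \<noteq> 1"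
  then have lt: "abv (of_int k :: 'a) < 1"
    using abv_of_int_le_1[of k] by simp
  have "coprime k (int p)"
    using assms prime_p by (metis coprime_commute prime_imp_coprime prime_nat_int_transfer)
  then obtain u v where "u * k + v * int p = 1"
    by (metis bezout_int coprime_imp_gcd_eq_1)
  then have "(1 :: 'a) = of_int u * of_int k + of_int v * of_nat p"
    by (metis of_int_1 of_int_add of_int_mult of_int_of_nat_eq)
  then have "1 \<le> max (abv (of_int u * of_int k :: 'a)) (abv (of_int v * of_nat p :: 'a))"
    using abv_add_le_max abv_1 by metis
  moreover have "abv (of_int u * of_int k :: 'a) \<le> 1 * abv (of_int k :: 'a)"
    unfolding abv_mult by (intro mult_right_mono abv_of_int_le_1 abv_nonneg)
  moreover have "abv (of_int v * of_nat p :: 'a) \<le> 1 * (1 / real p)"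
    unfolding abv_mult abv_p by (intro mult_right_mono abv_of_int_le_1) auto
  moreover have "1 / real p < 1" using p_gt_1 by simp
  ultimately show False using lt by linarith
qed

lemma power_p_dvd_if_abv_le:
  assumes "abv (of_nat m :: 'a) \<le> (1 / real p) ^ N"
  shows "p ^ N dvd m"
  using assms
proof (induction N arbitrary: m)
  case (Suc N)
  have "(1 / real p) ^ Suc N < 1"
    using p_gt_1 by (intro power_less_one_iff[THEN iffD2]) auto
  then have "p dvd m"
    using Suc.prems abv_of_int_coprime[of "int m"] by fastforce
  then obtain m' where m: "m = p * m'" ..
  have "abv (of_nat m' :: 'a) \<le> (1 / real p) ^ N"
    using Suc.prems p_gt_1 unfolding m by (simp add: abv_mult abv_p field_simps)
  then show ?case using Suc.IH m by simp
qed simp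

lemma tendsto_iff_abv: "(f \<longlongrightarrow> (l::'a)) F \<longleftrightarrow> ((\<lambda>x. abv (f x - l)) \<longlongrightarrow> 0) F"
  by (subst tendsto_dist_iff) (simp add: dist_abv)

lemma of_nat_in_Z_p: "(of_nat n :: 'a) \<in> Z_p"
  using closure_subset[of "\<rat> :: 'a set"] abv_of_nat_le_1
  by (auto simp: Z_p_def Q_p_def)

text \<open>
  A rational number \<open>a / b\<close> of absolute value at most one has denominator prime to \<open>p\<close> in lowest terms,
  so \<open>b\<close> is invertible modulo \<open>p ^ N\<close> and \<open>a / b\<close> is approximated by a natural number congruent to
  \<open>a\<close> times the inverse of \<open>b\<close>.
\<close>

lemma rational_near_nat:
  assumes "r \<in> \<rat>" "abv (r :: 'a) \<le> 1"
  shows "\<exists>m. abv (r - of_nat m) \<le> (1 / real p) ^ N"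
proof -
  obtain a b where ab: "b > 0" "coprime a b" "r = of_int a / of_int b"
    using assms(1) by (auto elim: Rats_cases')
  then have rb: "of_int a = r * of_int b" by simp
  have "\<not> int p dvd b"
  proof
    assume pb: "int p dvd b"
    have "\<not> int p dvd a"
    proof
      assume "int p dvd a"
      then have "is_unit (int p)" using ab(2) pb by (metis coprime_common_divisor)
      then show False using p_gt_1 by simp
    qed
    then have "1 = abv r * abv (of_int b :: 'a)"
      using abv_of_int_coprime[of a] rb by (simp add: abv_mult)
    also have "\<dots> \<le> 1 * abv (of_int b :: 'a)"
      using assms(2) by (intro mult_right_mono abv_nonneg)
    also obtain c where "b = int p * c" using pb ..
    then have "1 * abv (of_int b :: 'a) \<le> 1 / real p"
      using mult_left_mono[OF abv_of_int_le_1[of c], of "1 / real p"]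
      by (simp add: abv_mult abv_p)
    finally show False using p_gt_1 by simp
  qed
  \<comment> \<open>In the Bezout relation below, \<open>u\<close> is the inverse of \<open>b\<close> modulo \<open>p ^ N\<close>.\<close>
  then have b1: "abv (of_int b :: 'a) = 1" and "coprime b (int p ^ N)"
    using abv_of_int_coprime prime_p
    by (auto intro!: coprime_power_right_iff[THEN iffD2] disjI1
          simp: coprime_commute[of b] prime_imp_coprime)
  then obtain u v where uv: "u * b + v * int p ^ N = 1"
    by (metis bezout_int coprime_imp_gcd_eq_1)
  define m where "m = nat ((u * a) mod int p ^ N)"
  have m: "int m = (u * a) mod int p ^ N"
    using p_gt_1 by (simp add: m_def)
  have "int p ^ N dvd a - int m * b"
  proof -
    have "int p ^ N dvd (u * a - int m) * b"
      by (simp add: m minus_mod_eq_mult_div)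
    moreover have "a - int m * b = (u * a - int m) * b + a * v * int p ^ N"
      using arg_cong[OF uv, of "\<lambda>t. a * t"] by (simp add: algebra_simps)
    ultimately show ?thesis by simp
  qed
  then obtain c where c: "a - int m * b = int p ^ N * c" ..
  have "(r - of_nat m) * of_int b = of_int (a - int m * b)"
    using rb by (simp add: algebra_simps)
  also have "abv \<dots> \<le> (1 / real p) ^ N"
    using mult_left_mono[OF abv_of_int_le_1[of c], of "(1 / real p) ^ N"]
    unfolding c by (simp add: abv_mult abv_p abv_power)
  finally show ?thesis using b1 by (auto simp: abv_mult)
qed

lemma Q_p_approx:
  assumes "x \<in> Q_p" "e > 0"
  obtains r :: 'a where "r \<in> \<rat>" "dist r x < e"
proof -
  have "\<exists>r\<in>\<rat>. dist r x < e"
    using assms unfolding Q_p_def closure_approachable by simp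
  then show ?thesis using that by (elim bexE)
qed

lemma Z_p_subset_closure_Nats: "(Z_p :: 'a set) \<subseteq> closure \<nat>"
proof
  fix x :: 'a assume x: "x \<in> Z_p"
  show "x \<in> closure \<nat>"
    unfolding closure_approachable
  proof (intro allI impI)
    fix e :: real assume e: "e > 0"
    \<comment> \<open>Distance below \<open>1\<close> keeps the rational approximation in the unit ball.\<close>
    have "x \<in> Q_p" "min e 1 > 0" using x e by (auto simp: Z_p_def)
    then obtain r where r: "r \<in> \<rat>" "dist r x < min e 1"
      by (rule Q_p_approx)
    have "abv r \<le> 1"
      using abv_add_le_max[of "r - x" x] r x by (auto simp: Z_p_def dist_abv)
    obtain N where N: "(1 / real p) ^ N < e"
      using real_arch_pow_inv[OF e, of "1 / real p"] p_gt_1 by auto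
    obtain m where "abv (r - of_nat m) \<le> (1 / real p) ^ N"
      using rational_near_nat r(1) \<open>abv r \<le> 1\<close> by blast
    then have "dist (of_nat m) r < e"
      using N by (simp add: dist_abv abv_diff_commute[of "of_nat m"])
    then have "dist (of_nat m) x < e"
      using dist_ultrametric[of "of_nat m" x r] r(2) by linarith
    then show "\<exists>y\<in>\<nat>. dist y x < e" by auto
  qed
qed

lemma Z_p_sequence:
  assumes "x \<in> Z_p"
  obtains m :: "nat \<Rightarrow> nat" where "(\<lambda>k. of_nat (m k)) \<longlonglongrightarrow> (x :: 'a)"
proof -
  have "x \<in> closure \<nat>"
    using assms Z_p_subset_closure_Nats by blast
  then obtain s where s: "\<And>k. s k \<in> \<nat>" "s \<longlonglongrightarrow> x"
    unfolding closure_sequential by blast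
  have "\<exists>m. s = (\<lambda>k. of_nat (m k))"
    using s(1) by (metis Nats_cases)
  then show ?thesis using s(2) that by blast
qed

lemma Q_p_add:
  assumes "x \<in> Q_p" "y \<in> Q_p"
  shows "x + y \<in> (Q_p :: 'a set)"
  unfolding Q_p_def closure_approachable
proof (intro allI impI)
  fix e :: real assume e: "e > 0"
  obtain r where r: "r \<in> \<rat>" "dist r x < e"
    using Q_p_approx[OF assms(1) e] .
  obtain s where s: "s \<in> \<rat>" "dist s y < e"
    using Q_p_approx[OF assms(2) e] .
  have "abv ((r - x) + (s - y)) < e"
    using abv_add_le_max[of "r - x" "s - y"] r s unfolding dist_abv by linarith
  then have "dist (r + s) (x + y) < e"
    by (simp add: dist_abv algebra_simps)
  then show "\<exists>t\<in>\<rat>. dist t (x + y) < e" using r s by (meson Rats_add)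
qed

lemma Q_p_minus:
  assumes "x \<in> Q_p"
  shows "- x \<in> (Q_p :: 'a set)"
  unfolding Q_p_def closure_approachable
proof (intro allI impI)
  fix e :: real assume e: "e > 0"
  obtain r where r: "r \<in> \<rat>" "dist r x < e"
    using Q_p_approx[OF assms e] .
  have "dist (- r) (- x) < e"
    using r(2) abv_minus[of "r - x"] by (simp add: dist_abv)
  then show "\<exists>t\<in>\<rat>. dist t (- x) < e" using r(1) by (meson Rats_minus_iff)
qed

lemma Z_p_add: "x \<in> Z_p \<Longrightarrow> y \<in> Z_p \<Longrightarrow> x + y \<in> (Z_p :: 'a set)"
  using Q_p_add abv_add_le_max[of x y] by (auto simp: Z_p_def)

lemma Z_p_minus: "x \<in> Z_p \<Longrightarrow> - x \<in> (Z_p :: 'a set)"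
  using Q_p_minus by (auto simp: Z_p_def abv_minus)

lemma Z_p_diff: "x \<in> Z_p \<Longrightarrow> y \<in> Z_p \<Longrightarrow> x - y \<in> (Z_p :: 'a set)"
  using Z_p_add[of x "- y"] Z_p_minus by simp

end

section \<open>The function \<open>qpow q\<close> on \<open>Z_p\<close>\<close>

locale padic_q_base = padic_complex_field p T
  for p :: nat and T :: "'a :: {field_char_0, complete_space} itself" +
  fixes q :: 'a
  assumes q_near_1: "abv (1 - q) < 1" and not_root: "\<And>m::nat. m > 0 \<Longrightarrow> q ^ m \<noteq> 1"
begin

lemma abv_q: "abv q = 1"
proof (rule antisym)
  show "abv q \<le> 1"
    using abv_diff_le_max[of 1 "1 - q"] q_near_1 abv_1 by simp
  show "1 \<le> abv q"
    using abv_add_le_max[of "1 - q" q] q_near_1 abv_1 by (simp add: le_max_iff_disj)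
qed

lemma q_neq_0: "q \<noteq> 0"
  using abv_q abv_eq_0_iff[of q] by auto

lemma q_neq_1: "q \<noteq> 1"
  using not_root[of 1] by simp

lemma abv_1_minus_power_le:
  assumes "abv u \<le> 1"
  shows "abv (1 - u ^ k) \<le> abv (1 - u :: 'a)"
proof -
  have "abv (\<Sum>j<k. u ^ j) \<le> 1"
    using assms by (intro abv_sum_le) (auto simp: abv_power power_le_one abv_nonneg)
  then have "abv (1 - u) * abv (\<Sum>j<k. u ^ j) \<le> abv (1 - u) * 1"
    by (intro mult_left_mono abv_nonneg)
  then show ?thesis
    by (simp add: one_diff_power_eq abv_mult)
qed

text \<open>
  With \<open>u = q ^ (p ^ N)\<close>, the quotient of \<open>1 - u ^ p\<close> by \<open>1 - u\<close> is \<open>\<Sum>j<p. u ^ j\<close>, which differs from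
  \<open>p\<close> by a sum of terms \<open>1 - u ^ j\<close>, each of absolute value at most
  \<open>abv (1 - q)\<close>. So each \<open>p\<close>-th power gains the factor
  \<open>max (1 / p) (abv (1 - q)) < 1\<close>.
\<close>

lemma abv_1_minus_q_power_p_le:
  "abv (1 - q ^ (p ^ N)) \<le> max (1 / real p) (abv (1 - q)) ^ N"
proof (induction N)
  case 0
  then show ?case using q_near_1 by simp
next
  case (Suc N)
  define u where "u = q ^ (p ^ N)"
  define s where "s = max (1 / real p) (abv (1 - q))"
  have s0: "0 \<le> s" by (simp add: s_def le_max_iff_disj)
  have u1: "abv u = 1" by (simp add: u_def abv_power abv_q)
  have us: "abv (1 - u) \<le> s"
    using abv_1_minus_power_le[of q "p ^ N"] abv_q by (simp add: u_def s_def)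
  have "abv (\<Sum>j<p. 1 - u ^ j) \<le> s"
    using abv_1_minus_power_le[of u] us u1 s0 by (intro abv_sum_le) (auto intro: order_trans)
  moreover have "(\<Sum>j<p. u ^ j) = of_nat p - (\<Sum>j<p. 1 - u ^ j)"
    by (simp add: sum_subtractf)
  ultimately have "abv (\<Sum>j<p. u ^ j) \<le> s"
    using abv_diff_le_max[of "of_nat p" "\<Sum>j<p. 1 - u ^ j"] abv_p by (simp add: s_def)
  then have "abv (1 - u ^ p) \<le> s ^ N * s"
    using Suc unfolding one_diff_power_eq abv_mult u_def[symmetric] s_def[symmetric]
    by (intro mult_mono abv_nonneg) (auto simp: s0)
  moreover have "u ^ p = q ^ (p ^ Suc N)"
    by (simp add: u_def mult.commute flip: power_mult)
  ultimately show ?case by (simp add: s_def mult.commute)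
qed

lemma abv_1_minus_q_power_p_tendsto_0: "(\<lambda>N. abv (1 - q ^ (p ^ N))) \<longlonglongrightarrow> 0"
proof (rule tendsto_sandwich[of "\<lambda>_. 0"])
  show "(\<lambda>N. max (1 / real p) (abv (1 - q)) ^ N) \<longlonglongrightarrow> 0"
    using p_gt_1 q_near_1 by (intro LIMSEQ_realpow_zero) (auto simp: le_max_iff_disj)
qed (use abv_1_minus_q_power_p_le abv_nonneg in auto)

text \<open>
  Natural numbers closer than \<open>p ^ (- N)\<close> differ by a multiple of \<open>p ^ N\<close>, so their powers of \<open>q\<close>
  differ by no more than \<open>1\<close> and \<open>q ^ (p ^ N)\<close> do.
\<close>

lemma q_power_uniformly_continuous:
  assumes "e > 0"
  shows "\<exists>d>0. \<forall>m n. dist (of_nat m) (of_nat n :: 'a) < d \<longrightarrow> dist (q ^ m) (q ^ n) < e"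
proof -
  obtain N where N: "abv (1 - q ^ (p ^ N)) < e"
    using order_tendstoD(2)[OF abv_1_minus_q_power_p_tendsto_0 assms]
    by (auto simp: eventually_sequentially)
  have main: "dist (q ^ m) (q ^ n) < e"
    if "m \<le> n" and d: "dist (of_nat m) (of_nat n :: 'a) < (1 / real p) ^ N" for m n
  proof -
    have "abv (of_nat (n - m) :: 'a) \<le> (1 / real p) ^ N"
      using d \<open>m \<le> n\<close> by (simp add: dist_abv of_nat_diff abv_diff_commute)
    then have "p ^ N dvd n - m"
      by (rule power_p_dvd_if_abv_le)
    then obtain c where c: "n - m = p ^ N * c" ..
    have "q ^ m - q ^ n = q ^ m * (1 - q ^ (n - m))"
      using \<open>m \<le> n\<close> by (simp add: right_diff_distrib flip: power_add)
    also have "abv \<dots> = abv (1 - (q ^ (p ^ N)) ^ c)"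
      by (simp add: abv_mult abv_power abv_q c power_mult)
    also have "\<dots> \<le> abv (1 - q ^ (p ^ N))"
      by (rule abv_1_minus_power_le) (simp add: abv_power abv_q)
    finally show ?thesis using N by (simp add: dist_abv)
  qed
  have "dist (q ^ m) (q ^ n) < e" if "dist (of_nat m) (of_nat n :: 'a) < (1 / real p) ^ N" for m n
    using main[of m n] main[of n m] that by (cases "m \<le> n") (auto simp: dist_commute)
  moreover have "(1 / real p) ^ N > 0" using p_gt_1 by simp
  ultimately show ?thesis by blast
qed

lemma qpow_exists: "\<exists>f. continuous_on Z_p f \<and> (\<forall>m::nat. f (of_nat m :: 'a) = q ^ m)"
proof -
  define h where "h = (\<lambda>y::'a. q ^ (the_inv of_nat y :: nat))"
  have h: "h (of_nat m) = q ^ m" for m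
    by (simp add: h_def the_inv_f_f inj_of_nat)
  have "uniformly_continuous_on \<nat> h"
    unfolding uniformly_continuous_on_def
  proof (intro allI impI)
    fix e :: real assume "e > 0"
    then obtain d where "d > 0"
      "\<And>m n. dist (of_nat m) (of_nat n :: 'a) < d \<Longrightarrow> dist (q ^ m) (q ^ n) < e"
      using q_power_uniformly_continuous by blast
    then show "\<exists>d>0. \<forall>x\<in>\<nat>. \<forall>x'\<in>\<nat>. dist x' x < d \<longrightarrow> dist (h x') (h x) < e"
      by (intro exI[of _ d]) (auto simp: h elim!: Nats_cases)
  qed
  then obtain g where g: "uniformly_continuous_on (closure \<nat>) g" "\<And>y. y \<in> \<nat> \<Longrightarrow> h y = g y"
    using uniformly_continuous_on_extension_on_closure by metis
  have "continuous_on Z_p g"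
    using uniformly_continuous_imp_continuous[OF g(1)] Z_p_subset_closure_Nats
    by (rule continuous_on_subset)
  then show ?thesis using g(2) h by (metis of_nat_in_Nats)
qed

lemma
  shows qpow_continuous: "continuous_on Z_p (qpow q)"
    and qpow_of_nat: "qpow q (of_nat m) = q ^ m"
proof -
  have "continuous_on Z_p (qpow q) \<and> (\<forall>m::nat. qpow q (of_nat m) = q ^ m)"
    unfolding qpow_def by (rule someI_ex[OF qpow_exists])
  then show "continuous_on Z_p (qpow q)" "qpow q (of_nat m) = q ^ m"
    by blast+
qed

text \<open>
  Both sides are limits along natural numbers \<open>s k\<close> tending to \<open>x\<close>. The limits are handled through
  \<open>abv\<close>, as continuity of the field operations is not part of the sort of \<open>'a\<close>.
\<close>

lemma qpow_add_of_nat: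
  assumes "x \<in> Z_p"
  shows "qpow q (x + of_nat m) = q ^ m * qpow q x"
proof -
  obtain s :: "nat \<Rightarrow> nat" where s: "(\<lambda>k. of_nat (s k)) \<longlonglongrightarrow> x"
    using Z_p_sequence[OF assms] .
  have "(\<lambda>k. of_nat (s k + m)) \<longlonglongrightarrow> x + of_nat m"
    using s unfolding tendsto_iff_abv by simp
  then have "(\<lambda>k. qpow q (of_nat (s k + m))) \<longlonglongrightarrow> qpow q (x + of_nat m)"
    by (rule continuous_on_tendsto_compose[OF qpow_continuous])
       (use assms in \<open>simp_all add: Z_p_add of_nat_in_Z_p del: of_nat_add\<close>)
  moreover have "(\<lambda>k. q ^ (s k + m)) \<longlonglongrightarrow> q ^ m * qpow q x"
  proof -
    have "(\<lambda>k. qpow q (of_nat (s k))) \<longlonglongrightarrow> qpow q x"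
      by (rule continuous_on_tendsto_compose[OF qpow_continuous s])
         (use assms in \<open>simp_all add: of_nat_in_Z_p\<close>)
    then have "(\<lambda>k. abv (q ^ s k - qpow q x)) \<longlonglongrightarrow> 0"
      by (simp add: tendsto_iff_abv qpow_of_nat)
    moreover have "q ^ (s k + m) - q ^ m * qpow q x = q ^ m * (q ^ s k - qpow q x)" for k
      by (simp add: power_add algebra_simps)
    ultimately show ?thesis
      by (simp add: tendsto_iff_abv abv_mult abv_power abv_q)
  qed
  ultimately show ?thesis
    by (simp add: qpow_of_nat LIMSEQ_unique del: of_nat_add)
qed

lemma qpow_diff_of_nat:
  assumes "x \<in> Z_p"
  shows "qpow q (x - of_nat m) = qpow q x / q ^ m"
  using qpow_add_of_nat[OF Z_p_diff[OF assms of_nat_in_Z_p], of m m] q_neq_0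
  by (simp add: field_simps)

lemma qnum_of_nat: "qnum q (of_nat m) = (1 - q ^ m) / (1 - q)"
  by (simp add: qnum_def qpow_of_nat)

text \<open>
  Since \<open>qpow q (x - 1) = qpow q x / q\<close>, the inverse q-number of \<open>1 - x\<close> is
  \<open>(qpow q x - q) / (1 - q)\<close>.
\<close>

lemma qnum_add_qnum_inv:
  assumes "x \<in> Z_p"
  shows "qnum q x + qnum_inv q (1 - x) = 1"
proof -
  have "qpow q (- (1 - x)) = qpow q x / q"
    using qpow_diff_of_nat[OF assms, of 1] by simp
  then have "qnum_inv q (1 - x) = (1 - qpow q x / q) / (1 - inverse q)"
    by (simp add: qnum_inv_def)
  also have "\<dots> = (qpow q x - q) / (1 - q)"
    using q_neq_0 q_neq_1 by (simp add: field_simps)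
  finally show ?thesis
    using q_neq_1 by (simp add: qnum_def divide_simps)
qed

section \<open>The q-integrals\<close>

text \<open>
  The \<open>N\<close>-th Riemann sum is geometric with ratio \<open>q ^ (c + 1)\<close>. Divided by the q-number of \<open>p ^ N\<close> it
  is a constant times \<open>(1 - u ^ (c + 1)) / (1 - u) = \<Sum>j\<le>c. u ^ j\<close> with \<open>u = q ^ (p ^ N)\<close>, and the sum tends
  to \<open>c + 1\<close> as \<open>u\<close> tends to \<open>1\<close>. The hypothesis concerns natural arguments only because the integral
  samples its integrand there.
\<close>

lemma qintegral_q_power:
  assumes "\<And>m. f (of_nat m) = C * q ^ (c * m)"
  shows "qintegral p q f = C * (of_nat (c + 1) / qnum q (of_nat (c + 1)))"
proof -
  define u where "u = (\<lambda>N. q ^ (p ^ N))"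
  \<comment> \<open>The constant by which \<open>\<Sum>j\<le>c. u N ^ j\<close> is multiplied in the normalized Riemann sum.\<close>
  define K where "K = C / qnum q (of_nat (c + 1))"
  have u1: "u N \<noteq> 1" for N
    using not_root[of "p ^ N"] p_gt_1 by (simp add: u_def)
  have c1: "q ^ (c + 1) \<noteq> 1"
    using not_root[of "c + 1"] by simp
  have partial: "1 / qnum q (of_nat (p ^ N)) * (\<Sum>x<p ^ N. f (of_nat x) * q ^ x) =
      K * (\<Sum>j<c + 1. u N ^ j)" for N
  proof -
    have "(\<Sum>x<p ^ N. f (of_nat x) * q ^ x) = C * (\<Sum>x<p ^ N. (q ^ (c + 1)) ^ x)"
      unfolding sum_distrib_left by (intro sum.cong refl)
        (simp add: assms power_add power_mult_distrib flip: power_mult)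
    also have "(\<Sum>x<p ^ N. (q ^ (c + 1)) ^ x) = (1 - u N ^ (c + 1)) / (1 - q ^ (c + 1))"
      using one_diff_power_eq[of "q ^ (c + 1)" "p ^ N"] c1
      by (simp add: u_def field_simps flip: power_mult power_Suc)
    also have "1 - u N ^ (c + 1) = (1 - u N) * (\<Sum>j<c + 1. u N ^ j)"
      by (rule one_diff_power_eq)
    finally have sum_eq: "(\<Sum>x<p ^ N. f (of_nat x) * q ^ x) =
        C * ((1 - u N) * (\<Sum>j<c + 1. u N ^ j) / (1 - q ^ (c + 1)))" .
    have "1 / ((1 - w) / d) * (C * ((1 - w) * S / g)) = C / (g / d) * S"
      if "w \<noteq> 1" for w d S g :: 'a
      using that by simp
    from this[OF u1[of N]] show ?thesis
      unfolding K_def qnum_of_nat sum_eq u_def .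
  qed
  have "(\<lambda>N. K * (\<Sum>j<c + 1. u N ^ j)) \<longlonglongrightarrow> K * of_nat (c + 1)"
    unfolding tendsto_iff_abv
  proof (rule tendsto_sandwich[of "\<lambda>_. 0"])
    show "(\<lambda>N. abv K * abv (1 - u N)) \<longlonglongrightarrow> 0"
      using tendsto_mult_left[OF abv_1_minus_q_power_p_tendsto_0, of "abv K"]
      by (simp add: u_def)
    have "abv (K * (\<Sum>j<c + 1. u N ^ j) - K * of_nat (c + 1)) \<le> abv K * abv (1 - u N)" for N
    proof -
      have "abv (\<Sum>j<c + 1. 1 - u N ^ j) \<le> abv (1 - u N)"
        by (intro abv_sum_le abv_1_minus_power_le abv_nonneg)
           (simp add: u_def abv_power abv_q)
      moreover have "K * (\<Sum>j<c + 1. u N ^ j) - K * of_nat (c + 1) =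
          - (K * (\<Sum>j<c + 1. 1 - u N ^ j))"
        by (simp add: sum_subtractf algebra_simps)
      ultimately show ?thesis
        by (simp only: abv_minus abv_mult mult_left_mono abv_nonneg)
    qed
    then show "\<forall>\<^sub>F N in sequentially. abv (K * (\<Sum>j<c + 1. u N ^ j) - K * of_nat (c + 1))
        \<le> abv K * abv (1 - u N)" by simp
  qed (auto simp: abv_nonneg)
  then show ?thesis
    unfolding qintegral_def partial by (simp add: limI K_def)
qed

text \<open>
  The offset \<open>a\<close> makes the induction work: for the inner integrals, the outermost variable, sampled
  at a natural number \<open>m\<close>, just adds \<open>c (Suc k) * m\<close> to it.
\<close>

lemma qintegral_iter_qpow:
  "qintegral_iter p q k (\<lambda>x. qpow q (of_nat a + (\<Sum>l=1..k. of_nat (c l) * x l))) =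
   q ^ a * (\<Prod>l=1..k. of_nat (c l + 1) / qnum q (of_nat (c l + 1)))"
proof (induction k arbitrary: a)
  case 0
  then show ?case by (simp add: qpow_of_nat)
next
  case (Suc k)
  define R where "R = (\<Prod>l=1..k. of_nat (c l + 1) / qnum q (of_nat (c l + 1)))"
  have "qintegral_iter p q k (\<lambda>x. qpow q (of_nat a +
          (\<Sum>l=1..Suc k. of_nat (c l) * (x(Suc k := of_nat m)) l))) =
        q ^ a * R * q ^ (c (Suc k) * m)" for m
  proof -
    have "(\<Sum>l=1..k. of_nat (c l) * (x(Suc k := of_nat m)) l) = (\<Sum>l=1..k. of_nat (c l) * x l)"
      for x :: "nat \<Rightarrow> 'a"
      by (intro sum.cong) auto
    then have "(\<Sum>l=1..Suc k. of_nat (c l) * (x(Suc k := of_nat m)) l) =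
        (\<Sum>l=1..k. of_nat (c l) * x l) + of_nat (c (Suc k) * m)" for x :: "nat \<Rightarrow> 'a"
      by simp
    then have "of_nat a + (\<Sum>l=1..Suc k. of_nat (c l) * (x(Suc k := of_nat m)) l) =
        of_nat (a + c (Suc k) * m) + (\<Sum>l=1..k. of_nat (c l) * x l)" for x :: "nat \<Rightarrow> 'a"
      by (simp only: of_nat_add add_ac)
    then show ?thesis
      by (simp only: Suc.IH R_def) (simp only: power_add mult_ac)
  qed
  then have "qintegral p q (\<lambda>y. qintegral_iter p q k (\<lambda>x. qpow q (of_nat a +
          (\<Sum>l=1..Suc k. of_nat (c l) * (x(Suc k := y)) l)))) =
      q ^ a * R * (of_nat (c (Suc k) + 1) / qnum q (of_nat (c (Suc k) + 1)))"
    by (rule qintegral_q_power)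
  then show ?case
    by (simp add: R_def mult_ac)
qed

lemma qintegral_iter_bernoulli_weight:
  "qintegral_iter p q k (\<lambda>x. qpow q (\<Sum>l=1..k. of_nat (k - l + j) * x l)) =
   (\<Prod>m=1..k. of_nat (j + m) / ((1 - q ^ (j + m)) / (1 - q)))"
proof -
  have "qintegral_iter p q k (\<lambda>x. qpow q (\<Sum>l=1..k. of_nat (k - l + j) * x l)) =
        (\<Prod>l=1..k. of_nat (k - l + j + 1) / qnum q (of_nat (k - l + j + 1)))"
    using qintegral_iter_qpow[of k 0 "\<lambda>l. k - l + j"] by simp
  also have "\<dots> = (\<Prod>m=1..k. of_nat (j + m) / qnum q (of_nat (j + m)))"
    by (rule prod.reindex_bij_witness[of _ "\<lambda>m. k + 1 - m" "\<lambda>l. k + 1 - l"])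
       (auto simp: Suc_diff_le add_ac)
  finally show ?thesis
    by (simp only: qnum_of_nat)
qed

end

section \<open>Two expressions for a power of a q-number\<close>

theorem theorem7:
  fixes p :: nat and q x :: "'a :: {field_char_0, complete_space}" and i n :: nat
  assumes "prime p"
    and "padic_complex p TYPE('a)"
    and "abv (1 - q) < 1"
    and "\<And>m::nat. m > 0 \<Longrightarrow> q ^ m \<noteq> 1"
    and "i \<le> n"
    and "x \<in> Z_p"
  shows "(\<Sum>k=i..n. of_nat (k choose i) / of_nat (n choose i) * qbernstein k n x q) =
         (\<Sum>k=0..i. q ^ (k choose 2) * fact k * of_nat (i choose k) * qbinomial q x k *
                    inv_qbernoulli p q k (i - k))"
proof -
  interpret padic_q_base p "TYPE('a)" q
    using assms by unfold_locales auto
  have qbinom: "qbinomial q x k = (\<Prod>l<k. (1 - qpow q x / q ^ l) / (1 - q)) /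
      (\<Prod>l=1..k. (1 - q ^ l) / (1 - q))" for k
    by (simp only: qbinomial_def qfact_def qnum_of_nat)
       (simp add: qnum_def qpow_diff_of_nat[OF assms(6)])
  have "(\<Sum>k=i..n. of_nat (k choose i) / of_nat (n choose i) * qbernstein k n x q) =
        qnum q x ^ i"
    unfolding qbernstein_def
    by (rule sum_choose_bernstein[OF assms(5) qnum_add_qnum_inv[OF assms(6)]])
  also have "\<dots> = ((1 - qpow q x) / (1 - q)) ^ i"
    by (simp only: qnum_def)
  also have "\<dots> = (\<Sum>k=0..i. q ^ (k choose 2) * fact k * of_nat (i choose k) * qbinomial q x k *
                    inv_qbernoulli p q k (i - k))"
    unfolding qbinom inv_qbernoulli_def qintegral_iter_bernoulli_weight
    by (rule sum_inverse_bernoulli_expansion[symmetric]) (use q_neq_0 not_root in auto)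
  finally show ?thesis .
qed

end
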